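(* Let $I\subset\mathbb{R}$ be an open interval, $n\in\mathbb{N}$, $\alpha,\beta\in\,]-1,+\infty[$, $h>0$ and $f\in C^{n+1}(I)$. Then the minimal estimators of $f^{(n)}$ can also be written as $$\forall x\in I_h,\quad D^{(n)}_{h,\alpha,\beta}f(x)=\frac{\left\langle P_0^{(\alpha+n,\beta+n)}(t),\,f^{(n)}(x+ht)\right\rangle_{\alpha+n,\beta+n}}{\|P_0^{(\alpha+n,\beta+n)}\|^2_{\alpha+n,\beta+n}}\;P_0^{(\alpha+n,\beta+n)}(0).$$ Moreover, $$\forall x\in I_h,\quad D^{(n)}_{h,\alpha,\beta}f(x)=D^{(0)}_{h,\alpha+n,\beta+n}f^{(n)}(x).$$
   Context: $\mathbb{N}$ includes $0$. For $h>0$, $I_h:=\{x\in I:\ [x-h,x+h]\subset I\}$. For $\alpha,\beta>-1$: $P_n^{(\alpha,\beta)}(t)=\sum_{j=0}^{n}\binom{n+\alpha}{j}\binom{n+\beta}{n-j}\left(\frac{t-1}{2}\right)^{n-j}\left(\frac{t+1}{2}\right)^{j}$ is the $n$-th Jacobi polynomial, $w_{\alpha,\beta}(t)=(1-t)^{\alpha}(1+t)^{\beta}$, $\langle g_1(\cdot),g_2(\cdot)\rangle_{\alpha,\beta}=\int_{-1}^{1}w_{\alpha,\beta}(t)g_1(t)g_2(t)\,dt$ for $g_1,g_2\in C^0([-1,1])$, and $\|\cdot\|_{\alpha,\beta}$ is the associated norm. With $B(a,b)=\Gamma(a)\Gamma(b)/\Gamma(a+b)$, $$\rho_{n,\alpha,\beta}(t)=\frac{2^{-(n+\alpha+\beta+1)}\,n!}{B(n+\alpha+1,n+\beta+1)}P_n^{(\alpha,\beta)}(t)\,w_{\alpha,\beta}(t),$$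 and the minimal estimator of order $n$ of a function $g$ on $I$ is $D^{(n)}_{h,\alpha,\beta}g(x)=\frac{1}{h^{n}}\int_{-1}^{1}\rho_{n,\alpha,\beta}(t)g(x+ht)\,dt$ for $x\in I_h$; in particular this defines $D^{(0)}_{h,\alpha+n,\beta+n}$ applied to $g=f^{(n)}$. *)

theory Defs
  imports "HOL-Analysis.Analysis"
begin

text \<open>For open \<open>S\<close>, where \<open>deriv\<close> is determined by the values of \<open>f\<close> on \<open>S\<close>, this says
  that \<open>f\<close> is of class \<open>C\<^sup>k\<close> on \<open>S\<close>, with derivatives \<open>(deriv ^^ j) f\<close>, \<open>j \<le> k\<close>.\<close>
definition Ck_on :: "nat \<Rightarrow> (real \<Rightarrow> real) \<Rightarrow> real set \<Rightarrow> bool" where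
  "Ck_on k f S \<longleftrightarrow>
     (\<forall>j<k. (deriv ^^ j) f differentiable_on S) \<and> continuous_on S ((deriv ^^ k) f)"

definition inner_interval :: "real set \<Rightarrow> real \<Rightarrow> real set" where
  "inner_interval I h = {x \<in> I. {x - h..x + h} \<subseteq> I}"

definition jacobi_P :: "nat \<Rightarrow> real \<Rightarrow> real \<Rightarrow> real \<Rightarrow> real" where
  "jacobi_P n \<alpha> \<beta> t =
     (\<Sum>j=0..n. ((real n + \<alpha>) gchoose j) * ((real n + \<beta>) gchoose (n - j)) *
        ((t - 1) / 2) ^ (n - j) * ((t + 1) / 2) ^ j)"

text \<open>Since \<open>0 powr a = 0\<close> for every \<open>a\<close>, the values at \<open>t = 1\<close> and \<open>t = -1\<close> are conventional;
  the weight is used only under integrals over \<open>[-1, 1]\<close>.\<close>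
definition jacobi_weight :: "real \<Rightarrow> real \<Rightarrow> real \<Rightarrow> real" where
  "jacobi_weight \<alpha> \<beta> t = (1 - t) powr \<alpha> * (1 + t) powr \<beta>"

definition jacobi_inner :: "real \<Rightarrow> real \<Rightarrow> (real \<Rightarrow> real) \<Rightarrow> (real \<Rightarrow> real) \<Rightarrow> real" where
  "jacobi_inner \<alpha> \<beta> g1 g2 = (LBINT t:{-1..1}. jacobi_weight \<alpha> \<beta> t * g1 t * g2 t)"

definition jacobi_norm :: "real \<Rightarrow> real \<Rightarrow> (real \<Rightarrow> real) \<Rightarrow> real" where
  "jacobi_norm \<alpha> \<beta> g = sqrt (jacobi_inner \<alpha> \<beta> g g)"

definition jacobi_rho :: "nat \<Rightarrow> real \<Rightarrow> real \<Rightarrow> real \<Rightarrow> real" where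
  "jacobi_rho n \<alpha> \<beta> t =
     2 powr (- (real n + \<alpha> + \<beta> + 1)) * fact n / Beta (real n + \<alpha> + 1) (real n + \<beta> + 1) *
     jacobi_P n \<alpha> \<beta> t * jacobi_weight \<alpha> \<beta> t"

definition minimal_estimator ::
    "nat \<Rightarrow> real \<Rightarrow> real \<Rightarrow> real \<Rightarrow> (real \<Rightarrow> real) \<Rightarrow> real \<Rightarrow> real" where
  "minimal_estimator n h \<alpha> \<beta> g x =
     1 / h ^ n * (LBINT t:{-1..1}. jacobi_rho n \<alpha> \<beta> t * g (x + h * t))"

end

theory Submission
  imports Defs
begin

text \<open>
  The reason is Rodrigues' formula, which writes \<open>P\<^sub>n\<^sup>(\<^sup>\<alpha>\<^sup>,\<^sup>\<beta>\<^sup>) w\<^sub>\<alpha>\<^sub>,\<^sub>\<beta>\<close> as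
  \<open>(-1)\<^sup>n / (2\<^sup>n n!)\<close> times the \<open>n\<close>-th derivative of the weight with both exponents raised by
  \<open>n\<close>: integrating by parts \<open>n\<close> times moves all derivatives to \<open>t \<mapsto> f (x + h t)\<close>. Each of them
  yields a factor \<open>h\<close>, so \<open>h\<^sup>n\<close> cancels, and what remains is the integral of \<open>f\<^sup>(\<^sup>n\<^sup>) (x + h t)\<close>
  against the raised weight.

  Only one step of Rodrigues' formula is needed at a time: differentiating
  \<open>P\<^sub>m w\<close> with parameters \<open>\<alpha> + 1, \<beta> + 1\<close> gives \<open>-2 (m + 1) P\<^sub>m\<^sub>+\<^sub>1 w\<close> with parameters
  \<open>\<alpha>, \<beta>\<close> (\<open>jacobi_lowering_derivative\<close>). As \<open>\<alpha> + 1\<close> and \<open>\<beta> + 1\<close> are positive, the raised weight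
  is continuous and vanishes at \<open>\<plusminus>1\<close>, so there are no boundary terms
  (\<open>jacobi_integration_by_parts\<close>), and an induction that raises the parameters along the way
  gives the full reduction (\<open>jacobi_iterated_integration_by_parts\<close>).

  The constant in front works out because the total mass of the weight is a Beta integral
  (\<open>jacobi_weight_has_integral\<close>), and the mass of the raised weight is precisely what the
  normalisation of the minimal estimator divides by. Hence the estimator is the mean
  of \<open>f\<^sup>(\<^sup>n\<^sup>) (x + h t)\<close> for the raised weight
  (\<open>minimal_estimator_eq_mean_of_derivative\<close>). The right-hand sides of both claims are
  this same mean: the first because \<open>P\<^sub>0 = 1\<close>, which makes the
  squared norm the total mass, the second by the case of order \<open>0\<close>
  applied to \<open>f\<^sup>(\<^sup>n\<^sup>)\<close>.
\<close>

section \<open>The derivative of a weighted Jacobi polynomial\<close>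

text \<open>In the open interval the linear factors of the polynomial merge with the weight, so that each
  summand becomes a product of two real powers and can be differentiated directly.\<close>
lemma jacobi_P_times_weight_eq_sum:
  fixes \<alpha> \<beta> t :: real
  assumes "-1 < t" "t < 1"
  shows "jacobi_P n \<alpha> \<beta> t * jacobi_weight \<alpha> \<beta> t =
    (\<Sum>j\<le>n. ((real n + \<alpha>) gchoose j) * ((real n + \<beta>) gchoose (n - j)) * (-1) ^ (n - j) / 2 ^ n *
       ((1 - t) powr (\<alpha> + real (n - j)) * (1 + t) powr (\<beta> + real j)))"
proof -
  have "((t - 1) / 2) ^ (n - j) * ((t + 1) / 2) ^ j * jacobi_weight \<alpha> \<beta> t =
      (-1) ^ (n - j) / 2 ^ n * ((1 - t) powr (\<alpha> + real (n - j)) * (1 + t) powr (\<beta> + real j))"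
    if "j \<le> n" for j
  proof -
    have "(t - 1) ^ (n - j) = (-1) ^ (n - j) * (1 - t) ^ (n - j)"
      by (metis minus_diff_eq mult_minus1 power_mult_distrib)
    moreover have "(2::real) ^ n = 2 ^ (n - j) * 2 ^ j"
      using that by (simp flip: power_add)
    ultimately show ?thesis
      using assms by (simp add: jacobi_weight_def powr_add powr_realpow power_divide add.commute)
  qed
  then show ?thesis
    unfolding jacobi_P_def sum_distrib_right atLeast0AtMost
    by (intro sum.cong refl) (simp add: mult.assoc)
qed

lemma gbinomial_times_minus: "(a gchoose k) * (a - real k) = real (Suc k) * (a gchoose Suc k)"
  for a :: real
  by (metis gbinomial_absorb_comp gbinomial_absorption mult.commute)

text \<open>The upper arguments \<open>m + (\<alpha> + 1)\<close> and \<open>(m + 1) + \<alpha>\<close> of the binomial coefficients agree, so both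
  sides are combinations of the same products of powers. The product rule sends summand \<open>j\<close> to
  summands \<open>j + 1\<close> and \<open>j\<close> on the right, and the exponents it brings down are the factors
  \<open>A - j\<close> and \<open>B - (m - j)\<close> that turn \<open>A choose j\<close> into \<open>A choose (j + 1)\<close> and likewise for \<open>B\<close>.
  After shifting, summand \<open>j\<close> is collected with weights \<open>j\<close> and \<open>m + 1 - j\<close>, which add up to
  \<open>m + 1\<close>.\<close>
lemma jacobi_lowering_derivative:
  fixes \<alpha> \<beta> t :: real
  assumes t: "-1 < t" "t < 1"
  shows "((\<lambda>t. jacobi_P m (\<alpha> + 1) (\<beta> + 1) t * jacobi_weight (\<alpha> + 1) (\<beta> + 1) t)
     has_real_derivative
       - 2 * real (Suc m) * (jacobi_P (Suc m) \<alpha> \<beta> t * jacobi_weight \<alpha> \<beta> t)) (at t)"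
proof -
  define A B where "A = real (Suc m) + \<alpha>" and "B = real (Suc m) + \<beta>"
  have AB: "real m + (\<alpha> + 1) = A" "real m + (\<beta> + 1) = B"
    by (simp_all add: A_def B_def)
  define c where "c j = (A gchoose j) * (B gchoose (m - j)) * (-1) ^ (m - j) / 2 ^ m" for j
  \<comment> \<open>The summands of the right-hand side, without the factor \<open>1/2\<close> that the degree
    \<open>m + 1\<close> would contribute.\<close>
  define T where "T j = (A gchoose j) * (B gchoose (Suc m - j)) * (-1) ^ (Suc m - j) / 2 ^ m *
    ((1 - t) powr (\<alpha> + real (Suc m - j)) * (1 + t) powr (\<beta> + real j))" for j
  define S where "S u = (\<Sum>j\<le>m. c j *
    ((1 - u) powr (\<alpha> + 1 + real (m - j)) * (1 + u) powr (\<beta> + 1 + real j)))" for u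
  have term_deriv: "c j * ((- (\<alpha> + 1 + real (m - j)) * (1 - t) powr (\<alpha> + real (m - j)))
        * (1 + t) powr (\<beta> + 1 + real j)
      + (\<beta> + 1 + real j) * (1 + t) powr (\<beta> + real j) * (1 - t) powr (\<alpha> + 1 + real (m - j)))
     = - real (Suc j) * T (Suc j) - real (Suc m - j) * T j" (is "?L = ?R") if "j \<le> m" for j
  proof -
    have e: "\<alpha> + 1 + real (m - j) = A - real j" "\<beta> + 1 + real j = B - real (m - j)"
      and s: "Suc m - j = Suc (m - j)"
      and x: "\<alpha> + real (Suc m - j) = \<alpha> + 1 + real (m - j)" "\<beta> + real (Suc j) = \<beta> + 1 + real j"
      using that by (auto simp: A_def B_def)
    have 1: "- c j * (A - real j) =
       - real (Suc j) * ((A gchoose Suc j) * (B gchoose (m - j)) * (-1) ^ (m - j) / 2 ^ m)"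
    proof -
      have "- c j * (A - real j) =
         - ((A gchoose j) * (A - real j)) * ((B gchoose (m - j)) * (-1) ^ (m - j) / 2 ^ m)"
        by (simp add: c_def)
      then show ?thesis
        unfolding gbinomial_times_minus by (simp add: mult.assoc del: of_nat_Suc)
    qed
    have 2: "c j * (B - real (m - j)) =
       - real (Suc m - j) * ((A gchoose j) * (B gchoose (Suc m - j)) * (-1) ^ (Suc m - j) / 2 ^ m)"
    proof -
      have "c j * (B - real (m - j)) =
         (A gchoose j) * ((B gchoose (m - j)) * (B - real (m - j))) * ((-1) ^ (m - j) / 2 ^ m)"
        by (simp add: c_def)
      then show ?thesis
        unfolding gbinomial_times_minus s by (simp add: mult_ac del: of_nat_Suc)
    qed
    have "?L = (- c j * (A - real j)) * ((1 - t) powr (\<alpha> + real (m - j)) * (1 + t) powr (\<beta> + 1 + real j))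
       + (c j * (B - real (m - j))) * ((1 - t) powr (\<alpha> + 1 + real (m - j)) * (1 + t) powr (\<beta> + real j))"
      unfolding e[symmetric] by (simp add: algebra_simps)
    also have "\<dots> = ?R"
      unfolding 1 2 T_def x diff_Suc_Suc by (simp add: mult_ac del: of_nat_Suc)
    finally show ?thesis .
  qed
  have "(S has_real_derivative (\<Sum>j\<le>m. c j * ((- (\<alpha> + 1 + real (m - j)) * (1 - t) powr (\<alpha> + real (m - j)))
        * (1 + t) powr (\<beta> + 1 + real j)
      + (\<beta> + 1 + real j) * (1 + t) powr (\<beta> + real j) * (1 - t) powr (\<alpha> + 1 + real (m - j))))) (at t)"
    unfolding S_def
    using t by (intro DERIV_sum DERIV_cmult DERIV_mult) (auto intro!: derivative_eq_intros simp: algebra_simps)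
  also have "(\<Sum>j\<le>m. c j * ((- (\<alpha> + 1 + real (m - j)) * (1 - t) powr (\<alpha> + real (m - j)))
        * (1 + t) powr (\<beta> + 1 + real j)
      + (\<beta> + 1 + real j) * (1 + t) powr (\<beta> + real j) * (1 - t) powr (\<alpha> + 1 + real (m - j))))
      = (\<Sum>j\<le>m. - real (Suc j) * T (Suc j) - real (Suc m - j) * T j)"
    by (intro sum.cong refl term_deriv) simp
  also have "\<dots> = - (\<Sum>j\<le>m. real (Suc j) * T (Suc j)) - (\<Sum>j\<le>m. real (Suc m - j) * T j)"
    by (simp add: sum_subtractf sum_negf del: of_nat_Suc)
  \<comment> \<open>Both ranges extend to \<open>{..Suc m}\<close> because the added summand has factor \<open>0\<close>.\<close>
  also have "(\<Sum>j\<le>m. real (Suc j) * T (Suc j)) = (\<Sum>j\<le>Suc m. real j * T j)"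
    by (simp add: sum.atMost_Suc_shift del: sum.atMost_Suc of_nat_Suc)
  also have "(\<Sum>j\<le>m. real (Suc m - j) * T j) = (\<Sum>j\<le>Suc m. real (Suc m - j) * T j)"
    by simp
  also have "- (\<Sum>j\<le>Suc m. real j * T j) - (\<Sum>j\<le>Suc m. real (Suc m - j) * T j)
      = - (\<Sum>j\<le>Suc m. real (Suc m) * T j)"
    unfolding minus_add_distrib[symmetric] diff_conv_add_uminus sum.distrib[symmetric]
    by (intro arg_cong[of _ _ uminus] sum.cong refl) (auto simp: algebra_simps of_nat_diff)
  also have "\<dots> = - 2 * real (Suc m) * (jacobi_P (Suc m) \<alpha> \<beta> t * jacobi_weight \<alpha> \<beta> t)"
    unfolding jacobi_P_times_weight_eq_sum[OF t] sum_distrib_left A_def[symmetric] B_def[symmetric]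
      sum_negf[symmetric]
    by (intro sum.cong refl) (simp add: T_def del: of_nat_Suc)
  finally have D: "(S has_real_derivative
      - 2 * real (Suc m) * (jacobi_P (Suc m) \<alpha> \<beta> t * jacobi_weight \<alpha> \<beta> t)) (at t)" .
  have eq: "S u = jacobi_P m (\<alpha> + 1) (\<beta> + 1) u * jacobi_weight (\<alpha> + 1) (\<beta> + 1) u"
    if "u \<in> {-1<..<1}" for u
    using that by (simp add: S_def c_def jacobi_P_times_weight_eq_sum AB)
  show ?thesis
    by (rule has_field_derivative_transform_within_open[OF D, of "{-1<..<1}"]) (use t eq in auto)
qed

section \<open>Integrals against the weight\<close>

text \<open>The substitution \<open>t = 2 s - 1\<close> turns this into Euler's Beta integral on \<open>[0, 1]\<close>.\<close>
lemma jacobi_weight_has_integral: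
  fixes \<alpha> \<beta> :: real
  assumes "\<alpha> > -1" "\<beta> > -1"
  shows "(jacobi_weight \<alpha> \<beta> has_integral 2 powr (\<alpha> + \<beta> + 1) * Beta (\<alpha> + 1) (\<beta> + 1)) {-1..1}"
proof -
  have beta: "((\<lambda>t. t powr \<beta> * (1 - t) powr \<alpha>) has_integral Beta (\<beta> + 1) (\<alpha> + 1)) (cbox 0 (1::real))"
    using has_integral_Beta_real[of "\<beta> + 1" "\<alpha> + 1"] assms by simp
  have "(\<lambda>x. x * 2 - 1) ` {0..1} = {-1..1::real}"
  proof (intro set_eqI iffI)
    fix x :: real
    assume "x \<in> {-1..1}"
    then show "x \<in> (\<lambda>x. x * 2 - 1) ` {0..1}"
      by (intro image_eqI[of _ _ "(x + 1) / 2"]) (auto simp: field_simps)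
  qed auto
  then have "((\<lambda>t. (t / 2 + 1 / 2) powr \<beta> * (1 / 2 - t / 2) powr \<alpha>) has_integral
      2 * Beta (\<alpha> + 1) (\<beta> + 1)) {-1..1}"
    using has_integral_affinity[OF beta, of "1/2" "1/2"] by (simp add: Beta_commute algebra_simps)
  from has_integral_mult_right[OF this, of "2 powr (\<alpha> + \<beta>)"]
  have "((\<lambda>t. 2 powr (\<alpha> + \<beta>) * ((t / 2 + 1 / 2) powr \<beta> * (1 / 2 - t / 2) powr \<alpha>)) has_integral
      2 powr (\<alpha> + \<beta> + 1) * Beta (\<alpha> + 1) (\<beta> + 1)) {-1..1}"
    by (simp add: powr_add ac_simps)
  moreover have "2 powr (\<alpha> + \<beta>) * ((t / 2 + 1 / 2) powr \<beta> * (1 / 2 - t / 2) powr \<alpha>)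
      = jacobi_weight \<alpha> \<beta> t" if "t \<in> {-1..1}" for t
  proof -
    have halves: "t / 2 + 1 / 2 = (1 + t) / 2" "1 / 2 - t / 2 = (1 - t) / 2"
      by (simp_all add: field_simps)
    show ?thesis
      unfolding halves using that by (simp add: powr_divide powr_add jacobi_weight_def)
  qed
  ultimately show ?thesis
    by (rule has_integral_eq[rotated])
qed

lemma jacobi_weight_nonneg: "jacobi_weight \<alpha> \<beta> t \<ge> 0"
  by (simp add: jacobi_weight_def)

text \<open>For negative exponents the weight is unbounded at the endpoints, but it is nonnegative with a
  convergent integral, so it is absolutely integrable and remains so after multiplication by a
  bounded measurable function.\<close>
lemma set_integrable_continuous_times_jacobi_weight:
  fixes \<alpha> \<beta> :: real
  assumes "\<alpha> > -1" "\<beta> > -1" and g: "continuous_on {-1..1} g"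
  shows "set_integrable lborel {-1..1} (\<lambda>t. g t * jacobi_weight \<alpha> \<beta> t)"
proof -
  have meas: "jacobi_weight \<alpha> \<beta> \<in> borel_measurable borel"
    unfolding jacobi_weight_def by measurable
  have w: "jacobi_weight \<alpha> \<beta> absolutely_integrable_on {-1..1}"
    using jacobi_weight_has_integral[OF assms(1,2)]
    by (intro nonnegative_absolutely_integrable_1)
      (auto simp: jacobi_weight_nonneg dest: has_integral_integrable)
  have "g \<in> borel_measurable (lebesgue_on {-1..1})"
    using g by (intro continuous_imp_measurable_on_sets_lebesgue) auto
  moreover have "bounded (g ` {-1..1})"
    using g by (intro compact_imp_bounded compact_continuous_image) auto
  ultimately have "(\<lambda>t. g t * jacobi_weight \<alpha> \<beta> t) absolutely_integrable_on {-1..1}"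
    using w by (intro absolutely_integrable_bounded_measurable_product_real) auto
  moreover have "(\<lambda>t. indicat_real {-1..1} t *\<^sub>R (g t * jacobi_weight \<alpha> \<beta> t)) \<in> borel_measurable lborel"
    using borel_measurable_times[OF borel_measurable_continuous_on_indicator[OF _ g] meas]
    by (simp add: mult.assoc)
  ultimately show ?thesis
    unfolding set_integrable_def by (simp add: integrable_completion)
qed

lemma continuous_on_jacobi_P [continuous_intros]: "continuous_on S (jacobi_P n \<alpha> \<beta>)"
  unfolding jacobi_P_def by (intro continuous_intros) auto

section \<open>Integration by parts\<close>

text \<open>The function \<open>F\<close> below is continuous on the closed interval and vanishes at its ends, but it need
  not be differentiable there, as the weight with exponents \<open>\<alpha>, \<beta>\<close> may blow up. The fundamental theorem
  of calculus in the form that asks for a derivative only in the interior still applies.\<close>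
lemma jacobi_integration_by_parts:
  fixes \<alpha> \<beta> :: real
  assumes \<alpha>: "\<alpha> > -1" and \<beta>: "\<beta> > -1"
    and g: "continuous_on {-1..1} g" and g': "continuous_on {-1..1} g'"
    and deriv: "\<And>t. -1 < t \<Longrightarrow> t < 1 \<Longrightarrow> (g has_real_derivative g' t) (at t)"
  shows "2 * real (Suc m) * (LBINT t:{-1..1}. jacobi_P (Suc m) \<alpha> \<beta> t * jacobi_weight \<alpha> \<beta> t * g t)
     = (LBINT t:{-1..1}. jacobi_P m (\<alpha> + 1) (\<beta> + 1) t * jacobi_weight (\<alpha> + 1) (\<beta> + 1) t * g' t)"
proof -
  define p q where "p t = jacobi_P (Suc m) \<alpha> \<beta> t * jacobi_weight \<alpha> \<beta> t * g t"
    and "q t = jacobi_P m (\<alpha> + 1) (\<beta> + 1) t * jacobi_weight (\<alpha> + 1) (\<beta> + 1) t * g' t" for t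
  define F where "F t = jacobi_P m (\<alpha> + 1) (\<beta> + 1) t * jacobi_weight (\<alpha> + 1) (\<beta> + 1) t * g t" for t
  have p: "set_integrable lborel {-1..1} p"
    using set_integrable_continuous_times_jacobi_weight[OF \<alpha> \<beta>, of "\<lambda>t. jacobi_P (Suc m) \<alpha> \<beta> t * g t"]
    unfolding p_def by (simp add: mult_ac continuous_on_mult continuous_on_jacobi_P g)
  have q: "set_integrable lborel {-1..1} q"
    using set_integrable_continuous_times_jacobi_weight[of "\<alpha> + 1" "\<beta> + 1" "\<lambda>t. jacobi_P m (\<alpha> + 1) (\<beta> + 1) t * g' t"] \<alpha> \<beta>
    unfolding q_def by (simp add: mult_ac continuous_on_mult continuous_on_jacobi_P g')
  have "continuous_on {-1..1} F"
    unfolding F_def jacobi_weight_def using \<alpha> \<beta>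
    by (intro continuous_intros g continuous_on_powr') auto
  moreover have "(F has_vector_derivative - 2 * real (Suc m) * p t + q t) (at t)"
    if "t \<in> {-1<..<1}" for t
    unfolding has_real_derivative_iff_has_vector_derivative[symmetric] F_def
    using that
    by (auto intro!: DERIV_cong[OF DERIV_mult[OF jacobi_lowering_derivative deriv]] simp: p_def q_def)
  ultimately have "((\<lambda>t. - 2 * real (Suc m) * p t + q t) has_integral F 1 - F (-1)) {-1..1}"
    by (intro fundamental_theorem_of_calculus_interior) auto
  moreover have "F 1 - F (-1) = 0"
    by (simp add: F_def jacobi_weight_def)
  ultimately have "((\<lambda>t. - 2 * real (Suc m) * p t + q t) has_integral 0) {-1..1}"
    by simp
  moreover have "((\<lambda>t. - 2 * real (Suc m) * p t + q t) has_integral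
      - 2 * real (Suc m) * (LBINT t:{-1..1}. p t) + (LBINT t:{-1..1}. q t)) {-1..1}"
    using p q by (intro has_integral_add has_integral_mult_right)
      (simp_all add: set_borel_integral_eq_integral has_integral_integrable_integral)
  ultimately have "- 2 * real (Suc m) * (LBINT t:{-1..1}. p t) + (LBINT t:{-1..1}. q t) = 0"
    using has_integral_unique by blast
  then show ?thesis
    unfolding p_def q_def by linarith
qed

lemma jacobi_P_0 [simp]: "jacobi_P 0 \<alpha> \<beta> t = 1"
  by (simp add: jacobi_P_def)

text \<open>\<open>G k\<close> stands for the \<open>k\<close>-th derivative of \<open>G 0\<close>. With the whole sequence as a variable,
  the induction hypothesis can be used for the shifted sequence and for raised \<open>\<alpha>\<close> and \<open>\<beta>\<close>.\<close>
lemma jacobi_iterated_integration_by_parts: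
  fixes \<alpha> \<beta> :: real and G :: "nat \<Rightarrow> real \<Rightarrow> real"
  assumes "\<alpha> > -1" "\<beta> > -1"
    and "\<And>k. k \<le> n \<Longrightarrow> continuous_on {-1..1} (G k)"
    and "\<And>k t. k < n \<Longrightarrow> -1 < t \<Longrightarrow> t < 1 \<Longrightarrow> (G k has_real_derivative G (Suc k) t) (at t)"
  shows "2 ^ n * fact n * (LBINT t:{-1..1}. jacobi_P n \<alpha> \<beta> t * jacobi_weight \<alpha> \<beta> t * G 0 t)
     = (LBINT t:{-1..1}. jacobi_weight (\<alpha> + real n) (\<beta> + real n) t * G n t)"
  using assms
proof (induction n arbitrary: \<alpha> \<beta> G)
  case 0
  then show ?case by simp
next
  case (Suc n)
  have "2 ^ Suc n * fact (Suc n) * (LBINT t:{-1..1}. jacobi_P (Suc n) \<alpha> \<beta> t * jacobi_weight \<alpha> \<beta> t * G 0 t)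
     = 2 ^ n * fact n *
       (2 * real (Suc n) * (LBINT t:{-1..1}. jacobi_P (Suc n) \<alpha> \<beta> t * jacobi_weight \<alpha> \<beta> t * G 0 t))"
    by (simp add: mult_ac)
  also have "\<dots> = 2 ^ n * fact n *
      (LBINT t:{-1..1}. jacobi_P n (\<alpha> + 1) (\<beta> + 1) t * jacobi_weight (\<alpha> + 1) (\<beta> + 1) t * G (Suc 0) t)"
    using Suc.prems by (subst jacobi_integration_by_parts[where g' = "G (Suc 0)"]) auto
  also have "\<dots> = (LBINT t:{-1..1}.
      jacobi_weight (\<alpha> + 1 + real n) (\<beta> + 1 + real n) t * G (Suc n) t)"
    using Suc.prems by (intro Suc.IH[of _ _ "\<lambda>k. G (Suc k)"]) auto
  finally show ?case
    by (simp add: add.commute add.left_commute)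
qed

section \<open>Minimal estimators as weighted means\<close>

lemma jacobi_norm_1_squared:
  fixes \<alpha> \<beta> :: real
  assumes "\<alpha> > -1" "\<beta> > -1"
  shows "(jacobi_norm \<alpha> \<beta> (\<lambda>_. 1))\<^sup>2 = 2 powr (\<alpha> + \<beta> + 1) * Beta (\<alpha> + 1) (\<beta> + 1)"
proof -
  have "set_integrable lborel {-1..1} (jacobi_weight \<alpha> \<beta>)"
    using set_integrable_continuous_times_jacobi_weight[OF assms, of "\<lambda>_. 1"] by simp
  then have "jacobi_inner \<alpha> \<beta> (\<lambda>_. 1) (\<lambda>_. 1) = 2 powr (\<alpha> + \<beta> + 1) * Beta (\<alpha> + 1) (\<beta> + 1)"
    using jacobi_weight_has_integral[OF assms]
    by (simp add: jacobi_inner_def set_borel_integral_eq_integral integral_unique)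
  moreover have "Beta (\<alpha> + 1) (\<beta> + 1) \<ge> 0"
    using assms by (simp add: Beta_def)
  ultimately show ?thesis
    by (simp add: jacobi_norm_def)
qed

text \<open>The denominator is the total mass of the weight in the numerator. Of the power of \<open>2\<close> in it,
  \<open>2\<^sup>n\<close> comes from the integrations by parts and the rest from the normalisation of the estimator;
  the factorial produced by the integrations by parts cancels the one in the normalisation.\<close>
lemma minimal_estimator_eq_mean_of_derivative:
  fixes \<alpha> \<beta> h x :: real and f :: "real \<Rightarrow> real"
  assumes "open I" "\<alpha> > -1" "\<beta> > -1" "h > 0" and Ck: "Ck_on n f I" and sub: "{x - h..x + h} \<subseteq> I"
  shows "minimal_estimator n h \<alpha> \<beta> f x =
    (LBINT t:{-1..1}. jacobi_weight (\<alpha> + real n) (\<beta> + real n) t * (deriv ^^ n) f (x + h * t))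
    / (2 powr (\<alpha> + real n + (\<beta> + real n) + 1) * Beta (\<alpha> + real n + 1) (\<beta> + real n + 1))"
proof -
  define G where "G k t = h ^ k * (deriv ^^ k) f (x + h * t)" for k t
  have inI: "x + h * t \<in> I" if "-1 \<le> t" "t \<le> 1" for t
    using sub mult_left_mono[OF that(1), of h] mult_left_mono[OF that(2), of h] \<open>h > 0\<close> by auto
  have cont: "continuous_on I ((deriv ^^ k) f)" if "k \<le> n" for k
    using Ck that unfolding Ck_on_def
    by (cases "k = n") (auto intro: differentiable_imp_continuous_on)
  have D: "((deriv ^^ k) f has_real_derivative (deriv ^^ Suc k) f y) (at y)"
    if "k < n" "y \<in> I" for k y
  proof -
    have "(deriv ^^ k) f differentiable (at y)"
      using Ck that \<open>open I\<close> unfolding Ck_on_def differentiable_on_def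
      by (metis at_within_open)
    then show ?thesis
      by (simp add: DERIV_deriv_iff_real_differentiable)
  qed
  have "2 ^ n * fact n * (LBINT t:{-1..1}. jacobi_P n \<alpha> \<beta> t * jacobi_weight \<alpha> \<beta> t * G 0 t)
     = (LBINT t:{-1..1}. jacobi_weight (\<alpha> + real n) (\<beta> + real n) t * G n t)"
  proof (rule jacobi_iterated_integration_by_parts[OF assms(2,3)])
    show "continuous_on {-1..1} (G k)" if "k \<le> n" for k
      unfolding G_def using inI
      by (intro continuous_intros continuous_on_compose2[OF cont[OF that]]) auto
    show "(G k has_real_derivative G (Suc k) t) (at t)" if "k < n" "-1 < t" "t < 1" for k t
      unfolding G_def using that
      by (auto intro!: derivative_eq_intros DERIV_chain2[OF D] inI)
  qed
  also have "\<dots> = h ^ n *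
      (LBINT t:{-1..1}. jacobi_weight (\<alpha> + real n) (\<beta> + real n) t * (deriv ^^ n) f (x + h * t))"
    by (simp add: G_def mult.left_commute)
  finally have ibp: "(LBINT t:{-1..1}. jacobi_P n \<alpha> \<beta> t * jacobi_weight \<alpha> \<beta> t * f (x + h * t)) =
      h ^ n / (2 ^ n * fact n) *
      (LBINT t:{-1..1}. jacobi_weight (\<alpha> + real n) (\<beta> + real n) t * (deriv ^^ n) f (x + h * t))"
    by (simp add: G_def field_simps)
  have pow: "2 powr (\<alpha> + real n + (\<beta> + real n) + 1) = 2 ^ n * 2 powr (real n + \<alpha> + \<beta> + 1)"
    unfolding powr_realpow[OF zero_less_numeral, symmetric] powr_add[symmetric]
    by (simp add: ac_simps)
  have "(LBINT t:{-1..1}. jacobi_rho n \<alpha> \<beta> t * f (x + h * t)) =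
      2 powr (- (real n + \<alpha> + \<beta> + 1)) * fact n / Beta (real n + \<alpha> + 1) (real n + \<beta> + 1) *
      (LBINT t:{-1..1}. jacobi_P n \<alpha> \<beta> t * jacobi_weight \<alpha> \<beta> t * f (x + h * t))"
    unfolding jacobi_rho_def set_integral_mult_right[symmetric]
    by (simp only: mult.assoc)
  then have "minimal_estimator n h \<alpha> \<beta> f x = 1 / h ^ n *
      (2 powr (- (real n + \<alpha> + \<beta> + 1)) * fact n / Beta (real n + \<alpha> + 1) (real n + \<beta> + 1) *
      (h ^ n / (2 ^ n * fact n) *
      (LBINT t:{-1..1}. jacobi_weight (\<alpha> + real n) (\<beta> + real n) t * (deriv ^^ n) f (x + h * t))))"
    unfolding minimal_estimator_def ibp by simp
  then show ?thesis
    using \<open>h > 0\<close> by (simp only: pow powr_minus) (simp add: field_simps)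
qed

theorem proposition7:
  fixes I :: "real set" and n :: nat and \<alpha> \<beta> h :: real and f :: "real \<Rightarrow> real"
  assumes "open I" and "is_interval I"
    and "\<alpha> > -1" and "\<beta> > -1" and "h > 0"
    and "Ck_on (n + 1) f I"
  shows "(\<forall>x \<in> inner_interval I h.
            minimal_estimator n h \<alpha> \<beta> f x =
              jacobi_inner (\<alpha> + real n) (\<beta> + real n)
                (jacobi_P 0 (\<alpha> + real n) (\<beta> + real n))
                (\<lambda>t. (deriv ^^ n) f (x + h * t))
              / (jacobi_norm (\<alpha> + real n) (\<beta> + real n)
                   (jacobi_P 0 (\<alpha> + real n) (\<beta> + real n)))\<^sup>2
              * jacobi_P 0 (\<alpha> + real n) (\<beta> + real n) 0) \<and>
         (\<forall>x \<in> inner_interval I h.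
            minimal_estimator n h \<alpha> \<beta> f x =
              minimal_estimator 0 h (\<alpha> + real n) (\<beta> + real n) ((deriv ^^ n) f) x)"
proof -
  have P0: "jacobi_P 0 a b = (\<lambda>_. 1)" for a b
    by (rule ext) simp
  have Cn: "Ck_on n f I" and C0: "Ck_on 0 ((deriv ^^ n) f) I"
    using assms(6) by (auto simp: Ck_on_def intro: differentiable_imp_continuous_on)
  have ab: "\<alpha> + real n > -1" "\<beta> + real n > -1"
    using assms(3,4) by simp_all
  have est: "minimal_estimator n h \<alpha> \<beta> f x =
    (LBINT t:{-1..1}. jacobi_weight (\<alpha> + real n) (\<beta> + real n) t * (deriv ^^ n) f (x + h * t))
    / (2 powr (\<alpha> + real n + (\<beta> + real n) + 1) * Beta (\<alpha> + real n + 1) (\<beta> + real n + 1))"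
    if "x \<in> inner_interval I h" for x
    using minimal_estimator_eq_mean_of_derivative[OF assms(1,3,4,5) Cn] that
    by (simp add: inner_interval_def)
  have est0: "minimal_estimator 0 h (\<alpha> + real n) (\<beta> + real n) ((deriv ^^ n) f) x =
    (LBINT t:{-1..1}. jacobi_weight (\<alpha> + real n) (\<beta> + real n) t * (deriv ^^ n) f (x + h * t))
    / (2 powr (\<alpha> + real n + (\<beta> + real n) + 1) * Beta (\<alpha> + real n + 1) (\<beta> + real n + 1))"
    if "x \<in> inner_interval I h" for x
    using minimal_estimator_eq_mean_of_derivative[OF assms(1) ab assms(5) C0] that
    by (simp add: inner_interval_def)
  show ?thesis
    unfolding P0 jacobi_norm_1_squared[OF ab]
    by (auto simp: est est0 jacobi_inner_def)
qed

end
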